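(* Let $(A,\lhd,\rhd)$ be a pre-Novikov algebra over $\mathbb{C}$ and let $k\in\mathbb{C}$ be fixed. Define an operation $\circ$ on $A$ by $$a\circ b:=k(a\rhd b-b\lhd a),\qquad a,b\in A.$$ Then $(A,\lhd,\rhd,\circ)$ is a pre-Gel'fand-Dorfman algebra.
   Context: All vector spaces are over $\mathbb{C}$. A left-symmetric algebra $(A,\circ)$ is a vector space with a bilinear product satisfying $(a\circ b)\circ c-a\circ(b\circ c)=(b\circ a)\circ c-b\circ(a\circ c)$ for all $a,b,c\in A$. A pre-Novikov algebra $(A,\lhd,\rhd)$ is a vector space with two bilinear operations such that for all $a,b,c\in A$: $a\rhd(b\rhd c)=(a\rhd b+a\lhd b)\rhd c+b\rhd(a\rhd c)-(b\rhd a+b\lhd a)\rhd c$; $a\rhd(b\lhd c)=(a\rhd b)\lhd c+b\lhd(a\lhd c+a\rhd c)-(b\lhd a)\lhd c$; $(a\lhd b+a\rhd b)\rhd c=(a\rhd c)\lhd b$; $(a\lhd b)\lhd c=(a\lhd c)\lhd b$. A pre-Gel'fand-Dorfman algebra $(A,\lhd,\rhd,\circ)$ is a vector space such that $(A,\lhd,\rhd)$ is a pre-Novikov algebra, $(A,\circ)$ is a left-symmetric algebra, and for all $a,b,c\in A$: $c\lhd(a\circ b-b\circ a)-a\circ(c\lhd b)-(b\circ c)\lhd a=-b\circ(c\lhd a)-(a\circ c)\lhd b$; $(a\circ b-b\circ a)\rhd c+(a\lhd b+a\rhd b)\circ c=a\rhd(b\circ c)-b\circ(a\rhd c)+(a\circ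 c)\lhd b$. *)

theory Defs
  imports Complex_Main
begin

text \<open>
  A complex vector space is a type of class \<open>ab_group_add\<close> together with a scalar
  multiplication \<open>scale\<close> satisfying \<^locale>\<open>vector_space\<close>; the underlying set is the whole type.
\<close>

definition bilinear_product ::
  "(complex \<Rightarrow> 'a::ab_group_add \<Rightarrow> 'a) \<Rightarrow> ('a \<Rightarrow> 'a \<Rightarrow> 'a) \<Rightarrow> bool" where
  "bilinear_product scale f \<longleftrightarrow>
     (\<forall>a. Vector_Spaces.linear scale scale (\<lambda>b. f a b)) \<and>
     (\<forall>b. Vector_Spaces.linear scale scale (\<lambda>a. f a b))"

locale left_symmetric_algebra = vector_space scale
  for scale :: "complex \<Rightarrow> 'a::ab_group_add \<Rightarrow> 'a" +
  fixes circ :: "'a \<Rightarrow> 'a \<Rightarrow> 'a"  (infixl \<open>\<circ>\<^sub>A\<close> 75)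
  assumes bilinear_circ: "bilinear_product scale (\<circ>\<^sub>A)"
    and left_symmetric:
      "(a \<circ>\<^sub>A b) \<circ>\<^sub>A c - a \<circ>\<^sub>A (b \<circ>\<^sub>A c) = (b \<circ>\<^sub>A a) \<circ>\<^sub>A c - b \<circ>\<^sub>A (a \<circ>\<^sub>A c)"

locale pre_novikov_algebra = vector_space scale
  for scale :: "complex \<Rightarrow> 'a::ab_group_add \<Rightarrow> 'a" +
  fixes lhd :: "'a \<Rightarrow> 'a \<Rightarrow> 'a"  (infixl \<open>\<lhd>\<close> 75)
    and rhd :: "'a \<Rightarrow> 'a \<Rightarrow> 'a"  (infixl \<open>\<rhd>\<close> 75)
  assumes bilinear_lhd: "bilinear_product scale (\<lhd>)"
    and bilinear_rhd: "bilinear_product scale (\<rhd>)"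
    and rhd_rhd:
      "a \<rhd> (b \<rhd> c) = (a \<rhd> b + a \<lhd> b) \<rhd> c + b \<rhd> (a \<rhd> c) - (b \<rhd> a + b \<lhd> a) \<rhd> c"
    and rhd_lhd:
      "a \<rhd> (b \<lhd> c) = (a \<rhd> b) \<lhd> c + b \<lhd> (a \<lhd> c + a \<rhd> c) - (b \<lhd> a) \<lhd> c"
    and sum_rhd: "(a \<lhd> b + a \<rhd> b) \<rhd> c = (a \<rhd> c) \<lhd> b"
    and lhd_lhd: "(a \<lhd> b) \<lhd> c = (a \<lhd> c) \<lhd> b"

locale pre_gelfand_dorfman_algebra =
  pre_novikov_algebra scale lhd rhd + left_symmetric_algebra scale circ
  for scale :: "complex \<Rightarrow> 'a::ab_group_add \<Rightarrow> 'a"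
    and lhd :: "'a \<Rightarrow> 'a \<Rightarrow> 'a"  (infixl \<open>\<lhd>\<close> 75)
    and rhd :: "'a \<Rightarrow> 'a \<Rightarrow> 'a"  (infixl \<open>\<rhd>\<close> 75)
    and circ :: "'a \<Rightarrow> 'a \<Rightarrow> 'a"  (infixl \<open>\<circ>\<^sub>A\<close> 75) +
  assumes lhd_commutator:
      "c \<lhd> (a \<circ>\<^sub>A b - b \<circ>\<^sub>A a) - a \<circ>\<^sub>A (c \<lhd> b) - (b \<circ>\<^sub>A c) \<lhd> a
        = - (b \<circ>\<^sub>A (c \<lhd> a)) - (a \<circ>\<^sub>A c) \<lhd> b"
    and commutator_rhd:
      "(a \<circ>\<^sub>A b - b \<circ>\<^sub>A a) \<rhd> c + (a \<lhd> b + a \<rhd> b) \<circ>\<^sub>A c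
        = a \<rhd> (b \<circ>\<^sub>A c) - b \<circ>\<^sub>A (a \<rhd> c) + (a \<circ>\<^sub>A c) \<lhd> b"

end

theory Submission
  imports Defs
begin

text \<open>
  All the defining identities of a pre-Gel'fand-Dorfman algebra that involve \<open>\<circ>\<close> are homogeneous
  in \<open>\<circ>\<close>: left symmetry is quadratic, the two compatibility conditions are linear.  They therefore
  survive replacing \<open>\<circ>\<close> by a scalar multiple (lemma \<open>pre_gelfand_dorfman_scale\<close>), so it is enough
  to treat \<open>a \<circ> b = a \<rhd> b - b \<lhd> a\<close>, the case \<open>k = 1\<close>.

  Write \<open>a \<star> b = a \<lhd> b + a \<rhd> b\<close>.  The decisive observation is that \<open>\<circ>\<close> and \<open>\<star>\<close> have the same
  commutator \<open>[a, b]\<close>.  The first pre-Novikov identity then says that \<open>\<rhd>\<close> is a representation of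
  this bracket, \<open>[a, b] \<rhd> c = a \<rhd> (b \<rhd> c) - b \<rhd> (a \<rhd> c)\<close>.  The second one, antisymmetrised in two
  arguments, expresses \<open>c \<lhd> [a, b]\<close> through \<open>a \<rhd> (c \<lhd> b)\<close> and \<open>(a \<rhd> c) \<lhd> b\<close> only, because the term
  \<open>(c \<lhd> a) \<lhd> b\<close> is symmetric in \<open>a\<close> and \<open>b\<close>.  Left symmetry is the difference of these two
  statements, and the first compatibility condition is the second statement after cancelling
  terms symmetric in \<open>a\<close> and \<open>b\<close>.  The second compatibility condition combines the
  representation property with \<open>(a \<star> b) \<rhd> c = (a \<rhd> c) \<lhd> b\<close> and the second pre-Novikov identity
  itself, before antisymmetrisation.
\<close>

lemma bilinear_productD:
  assumes "bilinear_product scale f"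
  shows "f (a + b) c = f a c + f b c" "f a (b + c) = f a b + f a c"
    and "f (a - b) c = f a c - f b c" "f a (b - c) = f a b - f a c"
    and "f (scale r a) b = scale r (f a b)" "f a (scale r b) = scale r (f a b)"
proof -
  have L: "module_hom scale scale (\<lambda>a. f a b)" for b
    using assms unfolding bilinear_product_def Vector_Spaces.linear_iff_module_hom by blast
  have R: "module_hom scale scale (\<lambda>b. f a b)" for a
    using assms unfolding bilinear_product_def Vector_Spaces.linear_iff_module_hom by blast
  show "f (a + b) c = f a c + f b c" "f a (b + c) = f a b + f a c"
    "f (a - b) c = f a c - f b c" "f a (b - c) = f a b - f a c"
    "f (scale r a) b = scale r (f a b)" "f a (scale r b) = scale r (f a b)"
    using module_hom.add[OF L] module_hom.add[OF R] module_hom.diff[OF L] module_hom.diff[OF R]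
      module_hom.scale[OF L] module_hom.scale[OF R] by blast+
qed

lemma bilinear_productI:
  assumes "vector_space scale"
    and "\<And>a b c. f (a + b) c = f a c + f b c" "\<And>a b c. f a (b + c) = f a b + f a c"
    and "\<And>r a b. f (scale r a) b = scale r (f a b)" "\<And>r a b. f a (scale r b) = scale r (f a b)"
  shows "bilinear_product scale f"
  unfolding bilinear_product_def
  using assms
  by (auto simp: Vector_Spaces.linear_def module_hom_def module_hom_axioms_def
      module_iff_vector_space)

lemma left_symmetric_scale:
  assumes "left_symmetric_algebra scale circ"
  shows "left_symmetric_algebra scale (\<lambda>a b. scale k (circ a b))"
proof -
  interpret left_symmetric_algebra scale circ by fact
  note circ = bilinear_productD[OF bilinear_circ]
  show ?thesis
  proof
    show "bilinear_product scale (\<lambda>a b. scale k (circ a b))"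
      by (rule bilinear_productI[OF vector_space_axioms]) (simp_all add: circ scale_right_distrib mult.commute)
    show "scale k (circ (scale k (circ a b)) c) - scale k (circ a (scale k (circ b c)))
        = scale k (circ (scale k (circ b a)) c) - scale k (circ b (scale k (circ a c)))" for a b c
      using left_symmetric[of a b c]
      by (simp add: circ flip: scale_right_diff_distrib)
  qed
qed

text \<open>
  The compatibility conditions are linear in \<open>\<circ>\<close>, so the rescaled ones are the original ones
  multiplied by the scalar.
\<close>

lemma pre_gelfand_dorfman_scale:
  assumes "pre_gelfand_dorfman_algebra scale lhd rhd circ"
  shows "pre_gelfand_dorfman_algebra scale lhd rhd (\<lambda>a b. scale k (circ a b))"
proof -
  interpret pre_gelfand_dorfman_algebra scale lhd rhd circ by fact
  interpret scaled: left_symmetric_algebra scale "\<lambda>a b. scale k (circ a b)"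
    by (rule left_symmetric_scale) (fact left_symmetric_algebra_axioms)
  note lhd = bilinear_productD[OF bilinear_lhd]
  note rhd = bilinear_productD[OF bilinear_rhd]
  show ?thesis
  proof
    fix a b c
    show "lhd c (scale k (circ a b) - scale k (circ b a)) - scale k (circ a (lhd c b))
          - lhd (scale k (circ b c)) a
        = - scale k (circ b (lhd c a)) - lhd (scale k (circ a c)) b"
      using arg_cong[OF lhd_commutator[of c a b], of "scale k"]
      by (simp add: lhd scale_right_diff_distrib)
    show "rhd (scale k (circ a b) - scale k (circ b a)) c + scale k (circ (lhd a b + rhd a b) c)
        = rhd a (scale k (circ b c)) - scale k (circ b (rhd a c)) + lhd (scale k (circ a c)) b"
      using arg_cong[OF commutator_rhd[of a b c], of "scale k"]
      by (simp add: lhd rhd scale_right_diff_distrib scale_right_distrib)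
  qed
qed

context pre_novikov_algebra
begin

lemmas lhd_bilinear = bilinear_productD[OF bilinear_lhd]
lemmas rhd_bilinear = bilinear_productD[OF bilinear_rhd]

definition star :: "'a \<Rightarrow> 'a \<Rightarrow> 'a"  (infixl \<open>\<star>\<close> 75)
  where "a \<star> b = a \<lhd> b + a \<rhd> b"

definition circ :: "'a \<Rightarrow> 'a \<Rightarrow> 'a"  (infixl \<open>\<circ>\<^sub>N\<close> 75)
  where "a \<circ>\<^sub>N b = a \<rhd> b - b \<lhd> a"

lemma circ_commutator: "a \<circ>\<^sub>N b - b \<circ>\<^sub>N a = a \<star> b - b \<star> a"
  by (simp add: star_def circ_def)

lemma star_commutator_rhd: "(a \<star> b - b \<star> a) \<rhd> c = a \<rhd> (b \<rhd> c) - b \<rhd> (a \<rhd> c)"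
  using rhd_rhd[of a b c] by (simp add: star_def rhd_bilinear algebra_simps)

lemma lhd_star: "c \<lhd> (a \<star> b) = a \<rhd> (c \<lhd> b) - (a \<rhd> c) \<lhd> b + (c \<lhd> a) \<lhd> b"
  using rhd_lhd[of a c b] by (simp add: star_def)

text \<open>
  Antisymmetrising the previous identity removes its last term, as right multiplications
  by \<open>\<lhd>\<close> commute.
\<close>

lemma lhd_star_commutator:
  "c \<lhd> (a \<star> b - b \<star> a) = a \<rhd> (c \<lhd> b) - b \<rhd> (c \<lhd> a) - (a \<rhd> c) \<lhd> b + (b \<rhd> c) \<lhd> a"
  by (simp add: lhd_bilinear lhd_star lhd_lhd[of c b a])

lemma bilinear_circ: "bilinear_product scale (\<circ>\<^sub>N)"
  by (rule bilinear_productI[OF vector_space_axioms])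
    (simp_all add: circ_def lhd_bilinear rhd_bilinear scale_right_diff_distrib)

text \<open>
  Left symmetry says that \<open>[a, b] \<circ>\<^sub>N c = a \<circ>\<^sub>N (b \<circ>\<^sub>N c) - b \<circ>\<^sub>N (a \<circ>\<^sub>N c)\<close>.  The left side is
  \<open>[a, b] \<rhd> c - c \<lhd> [a, b]\<close>, and the two commutator identities above evaluate its two terms.
\<close>

lemma left_symmetric_circ: "left_symmetric_algebra scale (\<circ>\<^sub>N)"
proof
  show "bilinear_product scale (\<circ>\<^sub>N)" by (rule bilinear_circ)
  fix a b c
  have expand: "(a \<circ>\<^sub>N b) \<circ>\<^sub>N c - (b \<circ>\<^sub>N a) \<circ>\<^sub>N c = (a \<star> b - b \<star> a) \<rhd> c - c \<lhd> (a \<star> b - b \<star> a)"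
  proof -
    have "(a \<circ>\<^sub>N b) \<circ>\<^sub>N c - (b \<circ>\<^sub>N a) \<circ>\<^sub>N c = (a \<circ>\<^sub>N b - b \<circ>\<^sub>N a) \<circ>\<^sub>N c"
      by (simp add: bilinear_productD[OF bilinear_circ])
    then show ?thesis
      unfolding circ_commutator by (simp add: circ_def)
  qed
  have "a \<circ>\<^sub>N (b \<circ>\<^sub>N c) - b \<circ>\<^sub>N (a \<circ>\<^sub>N c)
      = a \<rhd> (b \<rhd> c) - b \<rhd> (a \<rhd> c)
        - (a \<rhd> (c \<lhd> b) - b \<rhd> (c \<lhd> a) - (a \<rhd> c) \<lhd> b + (b \<rhd> c) \<lhd> a)"
    by (simp add: circ_def lhd_bilinear rhd_bilinear lhd_lhd[of c b a])
  also have "\<dots> = (a \<circ>\<^sub>N b) \<circ>\<^sub>N c - (b \<circ>\<^sub>N a) \<circ>\<^sub>N c"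
    unfolding expand star_commutator_rhd lhd_star_commutator ..
  finally show "(a \<circ>\<^sub>N b) \<circ>\<^sub>N c - a \<circ>\<^sub>N (b \<circ>\<^sub>N c) = (b \<circ>\<^sub>N a) \<circ>\<^sub>N c - b \<circ>\<^sub>N (a \<circ>\<^sub>N c)"
    by (simp add: algebra_simps)
qed

lemma pre_gelfand_dorfman_circ: "pre_gelfand_dorfman_algebra scale (\<lhd>) (\<rhd>) (\<circ>\<^sub>N)"
proof -
  interpret left_symmetric_algebra scale "(\<circ>\<^sub>N)" by (rule left_symmetric_circ)
  show ?thesis
  proof
    fix a b c
    show "c \<lhd> (a \<circ>\<^sub>N b - b \<circ>\<^sub>N a) - a \<circ>\<^sub>N (c \<lhd> b) - (b \<circ>\<^sub>N c) \<lhd> a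
        = - (b \<circ>\<^sub>N (c \<lhd> a)) - (a \<circ>\<^sub>N c) \<lhd> b"
      unfolding circ_commutator lhd_star_commutator
      by (simp add: circ_def lhd_bilinear lhd_lhd[of c b a])
    have "(a \<star> b) \<circ>\<^sub>N c = (a \<rhd> c) \<lhd> b - c \<lhd> (a \<star> b)"
      using sum_rhd[of a b c] by (simp add: circ_def star_def)
    then show "(a \<circ>\<^sub>N b - b \<circ>\<^sub>N a) \<rhd> c + (a \<lhd> b + a \<rhd> b) \<circ>\<^sub>N c
        = a \<rhd> (b \<circ>\<^sub>N c) - b \<circ>\<^sub>N (a \<rhd> c) + (a \<circ>\<^sub>N c) \<lhd> b"
      unfolding circ_commutator star_commutator_rhd star_def[symmetric] lhd_star
      by (simp add: circ_def lhd_bilinear rhd_bilinear)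
  qed
qed

end

theorem proposition2p23:
  fixes scale :: "complex \<Rightarrow> 'a::ab_group_add \<Rightarrow> 'a"
    and lhd rhd :: "'a \<Rightarrow> 'a \<Rightarrow> 'a"
    and k :: complex
  assumes "pre_novikov_algebra scale lhd rhd"
  shows "pre_gelfand_dorfman_algebra scale lhd rhd
           (\<lambda>a b. scale k (rhd a b - lhd b a))"
proof -
  interpret pre_novikov_algebra scale lhd rhd by fact
  show ?thesis
    using pre_gelfand_dorfman_scale[OF pre_gelfand_dorfman_circ, of k]
    by (simp add: circ_def)
qed

end
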